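(* There exist an almost disjoint family $\{A_\xi:\xi<\omega_1\}\subseteq\wp(\mathbb{N})$ and a (linear) isometric embedding $S:\ell_\infty^c(\omega_1)\to C(\mathbb{N}^* )$ such that $S(1_{\{\xi\}})=1_{[A_\xi]}$ for every $\xi<\omega_1$.
   Context: All Banach spaces are over $\mathbb{R}$. An almost disjoint family is an infinite family of infinite subsets of $\mathbb{N}$ any two distinct members of which have finite intersection; an indexed family $\{A_\xi:\xi<\kappa\}$ is enumerated without repetitions. $\ell_\infty^c(\kappa)$ is the subspace of $\ell_\infty(\kappa)$ (supremum norm) consisting of the elements with countable support. $1_A$ is the characteristic function of $A$. $\mathbb{N}^*=\beta\mathbb{N}\setminus\mathbb{N}$, identified with the Stone space of $\wp(\mathbb{N})/Fin$; for $A\subseteq\mathbb{N}$, $[A]$ is the class of $A$ modulo finite sets, identified with the corresponding clopen subset of $\mathbb{N}^*$. $C(\mathbb{N}^* )$ carries the supremum norm. The statement is a theorem of $\mathsf{ZFC}$. *)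

theory Defs
  imports "HOL-Analysis.Bounded_Continuous_Function"
begin

section \<open>The index set \<open>\<omega>\<^sub>1\<close> and the space \<open>\<ell>\<^sub>\<infinity>\<^sup>c(\<omega>\<^sub>1)\<close>\<close>

text \<open>\<^term>\<open>cardSuc natLeq\<close> is the cardinal successor of \<open>\<aleph>\<^sub>0\<close>, so its field is a set of
  cardinality \<open>\<aleph>\<^sub>1\<close>. Only this cardinality matters below: no order on indices is used.\<close>

typedef omega1 = "Field (cardSuc natLeq)"
  using Cinfinite_cardSuc[OF natLeq_Cinfinite] czero_def
  by (metis Cinfinite_Cnotzero Cnotzero_imp_not_empty all_not_in_conv)

context
  includes cardinal_syntax
begin

lemma card_of_omega1: "|UNIV :: omega1 set| =o cardSuc natLeq"
proof -
  have "bij_betw Rep_omega1 UNIV (Field (cardSuc natLeq))"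
    using type_definition.Rep_range[OF type_definition_omega1]
    by (auto simp: bij_betw_def inj_def Rep_omega1_inject)
  then have "|UNIV :: omega1 set| =o |Field (cardSuc natLeq)|"
    using card_of_ordIso by blast
  also have "|Field (cardSuc natLeq)| =o cardSuc natLeq"
    by (intro card_of_Field_ordIso cardSuc_Card_order natLeq_Card_order)
  finally show ?thesis .
qed

end

text \<open>With the discrete topology on indices, the library space \<^typ>\<open>omega1 \<Rightarrow>\<^sub>C real\<close> consists of all
  bounded real functions on \<open>\<omega>\<^sub>1\<close> with the supremum norm, that is, it is \<open>\<ell>\<^sub>\<infinity>(\<omega>\<^sub>1)\<close>.\<close>

instantiation omega1 :: discrete_topology
begin
definition open_omega1 :: "omega1 set \<Rightarrow> bool"
  where "open_omega1 S \<longleftrightarrow> True"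
instance
  by standard (simp_all add: open_omega1_def)
end

lemma continuous_on_omega1: "continuous_on UNIV (f :: omega1 \<Rightarrow> 'b::topological_space)"
  by (simp add: continuous_on_open_vimage open_discrete)

unbundle bcontfun.lifting

definition linf_c :: "(omega1 \<Rightarrow>\<^sub>C real) set"
  where "linf_c = {x. countable {\<xi>. apply_bcontfun x \<xi> \<noteq> 0}}"

lift_definition char_point :: "omega1 \<Rightarrow> (omega1 \<Rightarrow>\<^sub>C real)"
  is "\<lambda>\<xi>. indicat_real {\<xi>}"
  by (auto simp: bcontfun_def indicator_def continuous_on_omega1
      intro!: finite_imp_bounded finite_subset[of _ "{0, 1}"])

lemma subspace_linf_c: "subspace linf_c"
proof -
  have "countable {\<xi>. apply_bcontfun (x + y) \<xi> \<noteq> 0}"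
    if "countable {\<xi>. apply_bcontfun x \<xi> \<noteq> 0}" "countable {\<xi>. apply_bcontfun y \<xi> \<noteq> 0}"
    for x y :: "omega1 \<Rightarrow>\<^sub>C real"
    by (rule countable_subset[OF _ countable_Un[OF that]]) (auto simp: plus_bcontfun.rep_eq)
  moreover have "countable {\<xi>. apply_bcontfun (c *\<^sub>R x) \<xi> \<noteq> 0}"
    if "countable {\<xi>. apply_bcontfun x \<xi> \<noteq> 0}" for x :: "omega1 \<Rightarrow>\<^sub>C real" and c
    by (rule countable_subset[OF _ that]) (auto simp: scaleR_bcontfun.rep_eq)
  ultimately show ?thesis
    by (auto simp: subspace_def linf_c_def zero_bcontfun.rep_eq)
qed

lemma char_point_in_linf_c: "char_point \<xi> \<in> linf_c"
  by (simp add: linf_c_def char_point.rep_eq indicator_def)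


section \<open>The space \<open>\<nat>\<^sup>* = \<beta>\<nat> - \<nat>\<close>\<close>

definition ultrafilter_on_nat :: "nat set set \<Rightarrow> bool"
  where "ultrafilter_on_nat U \<longleftrightarrow>
    {} \<notin> U \<and>
    (\<forall>A\<in>U. \<forall>B\<in>U. A \<inter> B \<in> U) \<and>
    (\<forall>A\<in>U. \<forall>B. A \<subseteq> B \<longrightarrow> B \<in> U) \<and>
    (\<forall>A. A \<in> U \<or> - A \<in> U)"

definition principal_at :: "nat \<Rightarrow> nat set set"
  where "principal_at n = {A. n \<in> A}"

lemma ultrafilter_on_nat_principal_at: "ultrafilter_on_nat (principal_at n)"
  by (auto simp: ultrafilter_on_nat_def principal_at_def)

lemma ultrafilter_Inter:
  assumes "ultrafilter_on_nat U" "finite F" "F \<subseteq> U"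
  shows "\<Inter>F \<in> U"
  using assms(2,3)
proof (induction F rule: finite_induct)
  case empty
  then show ?case using assms(1) unfolding ultrafilter_on_nat_def
    by (metis Compl_UNIV_eq Inter_empty)
next
  case (insert A F)
  then show ?case using assms(1) by (simp add: ultrafilter_on_nat_def)
qed

lemma ultrafilter_extension:
  assumes fip: "\<And>F. finite F \<Longrightarrow> F \<subseteq> G \<Longrightarrow> \<Inter>F \<noteq> ({} :: nat set)"
  shows "\<exists>U. ultrafilter_on_nat U \<and> G \<subseteq> U"
proof -
  define P where "P = {H. G \<subseteq> H \<and> (\<forall>F. finite F \<longrightarrow> F \<subseteq> H \<longrightarrow> \<Inter>F \<noteq> {})}"
  have "\<exists>M\<in>P. \<forall>X\<in>P. M \<subseteq> X \<longrightarrow> X = M"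
  proof (rule subset_Zorn_nonempty)
    show "P \<noteq> {}" using fip by (auto simp: P_def)
  next
    fix C assume C: "C \<noteq> {}" "subset.chain P C"
    have CP: "C \<subseteq> P" using C(2) by (simp add: subset_chain_def)
    have "\<Inter>F \<noteq> {}" if F: "finite F" "F \<subseteq> \<Union>C" for F
    proof -
      obtain B where "B \<in> C" "F \<subseteq> B"
        using finite_subset_Union_chain[OF F C] by blast
      then show ?thesis using CP F(1) by (auto simp: P_def)
    qed
    moreover have "G \<subseteq> \<Union>C" using C(1) CP by (auto simp: P_def)
    ultimately show "\<Union>C \<in> P" by (simp add: P_def)
  qed
  then obtain M where M: "M \<in> P" and max: "\<And>X. X \<in> P \<Longrightarrow> M \<subseteq> X \<Longrightarrow> X = M" by blast
  have Mfip: "\<Inter>F \<noteq> {}" if "finite F" "F \<subseteq> M" for F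
    using M that by (auto simp: P_def)
  have mem: "A \<in> M" if A: "\<And>F. finite F \<Longrightarrow> F \<subseteq> M \<Longrightarrow> \<Inter>F \<inter> A \<noteq> {}" for A
  proof -
    have "\<Inter>F \<noteq> {}" if F: "finite F" "F \<subseteq> insert A M" for F
    proof -
      have "\<Inter>(F - {A}) \<inter> A \<noteq> {}" using F by (intro A) auto
      then show ?thesis by auto
    qed
    then have "insert A M \<in> P" using M by (auto simp: P_def)
    then show ?thesis using max[of "insert A M"] by blast
  qed
  have "A \<in> M \<or> - A \<in> M" for A
  proof (rule ccontr)
    assume "\<not> (A \<in> M \<or> - A \<in> M)"
    then obtain F F' where F: "finite F" "F \<subseteq> M" "\<Inter>F \<inter> A = {}"
      and F': "finite F'" "F' \<subseteq> M" "\<Inter>F' \<inter> - A = {}"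
      using mem by metis
    then have "\<Inter>(F \<union> F') = {}" by blast
    then show False using Mfip[of "F \<union> F'"] F F' by simp
  qed
  moreover have "{} \<notin> M" using Mfip[of "{{}}"] by auto
  moreover have "A \<inter> B \<in> M" if "A \<in> M" "B \<in> M" for A B
  proof (rule mem)
    fix F assume "finite F" "F \<subseteq> M"
    then have "\<Inter>(insert A (insert B F)) \<noteq> {}" using that by (intro Mfip) auto
    then show "\<Inter>F \<inter> (A \<inter> B) \<noteq> {}" by auto
  qed
  moreover have "B \<in> M" if "A \<in> M" "A \<subseteq> B" for A B
  proof (rule mem)
    fix F assume "finite F" "F \<subseteq> M"
    then have "\<Inter>(insert A F) \<noteq> {}" using that by (intro Mfip) auto
    then show "\<Inter>F \<inter> B \<noteq> {}" using that by auto
  qed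
  ultimately have "ultrafilter_on_nat M" by (auto simp: ultrafilter_on_nat_def)
  then show ?thesis using M by (auto simp: P_def)
qed

lemma ultrafilter_nonprincipal_iff:
  assumes "ultrafilter_on_nat U"
  shows "U \<notin> range principal_at \<longleftrightarrow> (\<forall>A\<in>U. infinite A)"
proof
  assume np: "U \<notin> range principal_at"
  have up: "B \<in> U" if "A \<in> U" "A \<subseteq> B" for A B
    using assms that by (auto simp: ultrafilter_on_nat_def)
  have "- {n} \<in> U" for n
  proof (rule ccontr)
    assume "- {n} \<notin> U"
    then have n: "{n} \<in> U" using assms by (auto simp: ultrafilter_on_nat_def)
    have "U = principal_at n"
    proof (intro equalityI subsetI)
      fix A assume "A \<in> U"
      with n have "{n} \<inter> A \<in> U" "{} \<notin> U" using assms by (auto simp: ultrafilter_on_nat_def)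
      then show "A \<in> principal_at n" by (cases "n \<in> A") (auto simp: principal_at_def)
    next
      fix A assume "A \<in> principal_at n"
      then show "A \<in> U" using up[OF n] by (simp add: principal_at_def)
    qed
    with np show False by blast
  qed
  note cof = this
  show "\<forall>A\<in>U. infinite A"
  proof (intro ballI notI)
    fix A assume A: "A \<in> U" "finite A"
    have "\<Inter>(insert A ((\<lambda>n. - {n}) ` A)) \<in> U"
      using assms A cof by (intro ultrafilter_Inter) auto
    moreover have "\<Inter>(insert A ((\<lambda>n. - {n}) ` A)) = {}" by auto
    ultimately show False using assms by (simp add: ultrafilter_on_nat_def)
  qed
next
  assume "\<forall>A\<in>U. infinite A"
  moreover have "{n} \<in> principal_at n" for n by (simp add: principal_at_def)
  ultimately show "U \<notin> range principal_at" by blast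
qed

lemma free_ultrafilter_extension:
  assumes fip: "\<And>F. finite F \<Longrightarrow> F \<subseteq> G \<Longrightarrow> infinite (\<Inter>F :: nat set)"
  shows "\<exists>U. ultrafilter_on_nat U \<and> U \<notin> range principal_at \<and> G \<subseteq> U"
proof -
  have "\<exists>U. ultrafilter_on_nat U \<and> G \<union> range (\<lambda>n. - {n}) \<subseteq> U"
  proof (rule ultrafilter_extension)
    fix F assume F: "finite F" "F \<subseteq> G \<union> range (\<lambda>n::nat. - {n})"
    have "finite (F - G)" "F - G \<subseteq> range (\<lambda>n. - {n})" using F by auto
    then obtain N where N: "finite N" "F - G = (\<lambda>n. - {n}) ` N"
      by (metis finite_subset_image)
    have "infinite (\<Inter>(F \<inter> G) - N)"
      using F N(1) by (intro Diff_infinite_finite fip) auto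
    then have ne: "\<Inter>(F \<inter> G) - N \<noteq> {}" by (metis finite.emptyI)
    have "\<Inter>(F \<inter> G) - N = \<Inter>((F \<inter> G) \<union> (F - G))" unfolding N(2) by auto
    also have "(F \<inter> G) \<union> (F - G) = F" by auto
    finally show "\<Inter>F \<noteq> {}" using ne by simp
  qed
  then obtain U where U: "ultrafilter_on_nat U" "G \<subseteq> U" "\<And>n. - {n} \<in> U" by blast
  have "U \<noteq> principal_at n" for n
    using U(3)[of n] by (auto simp: principal_at_def)
  then show ?thesis using U by blast
qed

text \<open>\<open>\<beta>\<nat>\<close> is realised as the set of ultrafilters on \<open>\<nat>\<close>, with \<open>n\<close> identified with
  \<^term>\<open>principal_at n\<close>; the sets \<open>{U. A \<in> U}\<close> form a base of its topology, and the
  remainder carries the subspace topology.\<close>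

typedef nstar = "{U. ultrafilter_on_nat U \<and> U \<notin> range principal_at}"
  morphisms sets_of Abs_nstar
  using free_ultrafilter_extension[of "{}"] by auto

text \<open>\<^term>\<open>star A\<close> is the clopen subset of \<open>\<nat>\<^sup>*\<close> identified with the class \<open>[A]\<close> modulo finite
  sets; see \<open>star_eq_iff\<close>, \<open>clopen_star\<close>.\<close>

definition star :: "nat set \<Rightarrow> nstar set"
  where "star A = {p. A \<in> sets_of p}"

instantiation nstar :: topological_space
begin
definition open_nstar :: "nstar set \<Rightarrow> bool"
  where "open_nstar = generate_topology (range star)"
instance
  by standard (auto simp: open_nstar_def intro: generate_topology.intros)
end

lemma sets_of_ultrafilter: "ultrafilter_on_nat (sets_of p)"
  and sets_of_infinite: "A \<in> sets_of p \<Longrightarrow> infinite A"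
  using sets_of[of p] ultrafilter_nonprincipal_iff by auto

lemma star_Compl: "star (- A) = - star A"
proof -
  have "- A \<in> sets_of p \<longleftrightarrow> A \<notin> sets_of p" for p
    using sets_of_ultrafilter[of p] unfolding ultrafilter_on_nat_def
    by (metis Compl_disjoint)
  then show ?thesis by (auto simp: star_def)
qed

lemma star_Int: "star (A \<inter> B) = star A \<inter> star B"
proof -
  have "A \<inter> B \<in> sets_of p \<longleftrightarrow> A \<in> sets_of p \<and> B \<in> sets_of p" for p
    using sets_of_ultrafilter[of p] unfolding ultrafilter_on_nat_def
    by (metis Int_lower1 Int_lower2)
  then show ?thesis by (auto simp: star_def)
qed

lemma clopen_star: "open (star A)" "closed (star A)"
proof -
  show o: "open (star A)" for A
    by (auto simp: open_nstar_def intro: generate_topology.Basis)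
  show "closed (star A)"
    using o[of "- A"] by (simp add: closed_def star_Compl)
qed

lemma star_empty_iff: "star A = {} \<longleftrightarrow> finite A"
proof
  show "star A = {}" if "finite A"
    using that sets_of_infinite by (auto simp: star_def)
  show "finite A" if e: "star A = {}"
  proof (rule ccontr)
    assume "infinite A"
    then have "infinite (\<Inter>F)" if "F \<subseteq> {A}" for F
      using that by (cases "F = {}") (auto simp: subset_singleton_iff)
    then obtain U where "ultrafilter_on_nat U" "U \<notin> range principal_at" "A \<in> U"
      using free_ultrafilter_extension[of "{A}"] by auto
    then have "Abs_nstar U \<in> star A" by (simp add: star_def Abs_nstar_inverse)
    with e show False by simp
  qed
qed

lemma star_eq_iff: "star A = star B \<longleftrightarrow> finite ((A - B) \<union> (B - A))"
proof -
  have "star A = star B \<longleftrightarrow> star (A \<inter> - B) = {} \<and> star (B \<inter> - A) = {}"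
    by (auto simp: star_Int star_Compl)
  then show ?thesis by (simp add: star_empty_iff Diff_eq)
qed

text \<open>Since \<open>\<nat>\<^sup>*\<close> is compact, every continuous real function on it is bounded, so that
  \<open>C(\<nat>\<^sup>*)\<close> with the supremum norm is the library space \<^typ>\<open>nstar \<Rightarrow>\<^sub>C real\<close>.\<close>

lemma star_basis:
  assumes "open S" "p \<in> S"
  shows "\<exists>A. p \<in> star A \<and> star A \<subseteq> S"
  using assms unfolding open_nstar_def
proof (induction S rule: generate_topology.induct)
  case UNIV
  have "p \<in> star A \<or> p \<in> star (- A)" for A by (simp add: star_Compl)
  then show ?case by blast
next
  case (Int a b)
  then obtain A B where "p \<in> star A" "star A \<subseteq> a" "p \<in> star B" "star B \<subseteq> b" by auto
  then show ?case by (intro exI[of _ "A \<inter> B"]) (auto simp: star_Int)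
next
  case (UN K)
  then show ?case by blast
qed auto

lemma compact_nstar: "compact (UNIV :: nstar set)"
proof (rule compactI)
  fix C :: "nstar set set"
  assume op: "\<forall>B\<in>C. open B" and cov: "UNIV \<subseteq> \<Union>C"
  define G where "G = {A. \<exists>B\<in>C. star (- A) \<subseteq> B}"
  show "\<exists>C'\<subseteq>C. finite C' \<and> UNIV \<subseteq> \<Union>C'"
  proof (cases "\<forall>F. finite F \<longrightarrow> F \<subseteq> G \<longrightarrow> infinite (\<Inter>F)")
    case True
    then obtain U where U: "ultrafilter_on_nat U" "U \<notin> range principal_at" "G \<subseteq> U"
      using free_ultrafilter_extension[of G] by auto
    define p where "p = Abs_nstar U"
    have p: "sets_of p = U" using U by (simp add: p_def Abs_nstar_inverse)
    obtain B where B: "B \<in> C" "p \<in> B" using cov by auto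
    obtain A where A: "p \<in> star A" "star A \<subseteq> B" using star_basis op B by blast
    have "- A \<in> G" using A B by (auto simp: G_def)
    then have "p \<in> star (- A)" using U p by (auto simp: star_def)
    then show ?thesis using A by (simp add: star_Compl)
  next
    case False
    then obtain F where F: "finite F" "F \<subseteq> G" "finite (\<Inter>F)" by auto
    from F(2) have "\<forall>A\<in>F. \<exists>B\<in>C. star (- A) \<subseteq> B" by (auto simp: G_def)
    then obtain g where g: "\<And>A. A \<in> F \<Longrightarrow> g A \<in> C \<and> star (- A) \<subseteq> g A" by metis
    have "p \<in> \<Union>(g ` F)" for p
    proof (rule ccontr)
      assume np: "p \<notin> \<Union>(g ` F)"
      have "A \<in> sets_of p" if "A \<in> F" for A
      proof -
        have "p \<notin> star (- A)" using np g[OF that] that by auto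
        then show ?thesis by (simp add: star_Compl) (simp add: star_def)
      qed
      then have "\<Inter>F \<in> sets_of p"
        using F(1) by (intro ultrafilter_Inter sets_of_ultrafilter) auto
      then show False using sets_of_infinite F(3) by blast
    qed
    then show ?thesis using F(1) g by (intro exI[of _ "g ` F"]) auto
  qed
qed

lemma continuous_on_nstar_bcontfun:
  fixes f :: "nstar \<Rightarrow> real"
  shows "f \<in> bcontfun \<longleftrightarrow> continuous_on UNIV f"
  using compact_continuous_image[OF _ compact_nstar] compact_imp_bounded
  by (auto simp: bcontfun_def)

lift_definition char_star :: "nat set \<Rightarrow> (nstar \<Rightarrow>\<^sub>C real)"
  is "\<lambda>A. indicat_real (star A)"
proof -
  fix A
  show "indicat_real (star A) \<in> bcontfun"
    unfolding continuous_on_nstar_bcontfun continuous_on_open_vimage[OF open_UNIV]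
  proof (intro allI impI)
    fix B :: "real set"
    have "indicat_real (star A) -` B =
      (if 1 \<in> B then star A else {}) \<union> (if 0 \<in> B then star (- A) else {})"
      by (auto simp: indicator_def star_Compl split: if_splits split_of_bool_asm)
    then show "open (indicat_real (star A) -` B \<inter> UNIV)"
      using clopen_star by auto
  qed
qed


section \<open>Almost disjoint families and isometric embeddings\<close>

definition almost_disjoint_family :: "nat set set \<Rightarrow> bool"
  where "almost_disjoint_family \<A> \<longleftrightarrow>
    infinite \<A> \<and> (\<forall>A\<in>\<A>. infinite A) \<and> (\<forall>A\<in>\<A>. \<forall>B\<in>\<A>. A \<noteq> B \<longrightarrow> finite (A \<inter> B))"

text \<open>Linear isometric embedding of the subspace \<open>V\<close>; the values of \<open>S\<close> outside \<open>V\<close> are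
  irrelevant.\<close>

definition isometric_embedding_on ::
  "'a::real_normed_vector set \<Rightarrow> ('a \<Rightarrow> 'b::real_normed_vector) \<Rightarrow> bool"
  where "isometric_embedding_on V S \<longleftrightarrow>
    (\<forall>x\<in>V. \<forall>y\<in>V. S (x + y) = S x + S y) \<and>
    (\<forall>c. \<forall>x\<in>V. S (c *\<^sub>R x) = c *\<^sub>R S x) \<and>
    (\<forall>x\<in>V. norm (S x) = norm x)"

end

theory Submission
  imports Defs "HOL-Library.Countable_Set_Type"
begin

text \<open>The proof runs an Aronszajn-type recursion for maps into \<open>\<omega>\<^sub>1\<close>. For every \<open>a < \<omega>\<^sub>1\<close> one
  builds \<open>f\<^sub>a : \<nat> \<rightarrow> \<omega>\<^sub>1\<close> whose fibres over all \<open>\<xi> \<le> a\<close> are infinite, such that for \<open>a \<le> b\<close>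
  the maps \<open>f\<^sub>a\<close> and \<open>f\<^sub>b\<close> agree, up to finitely many arguments, wherever one of them takes a value
  \<open>\<le> a\<close>. For \<open>x\<close> supported in \<open>{\<xi>. \<xi> \<le> a}\<close> the class of \<open>x \<circ> f\<^sub>a\<close> in \<open>\<ell>\<^sub>\<infinity> / c\<^sub>0 = C(\<nat>\<^sup>*)\<close>
  then does not depend on \<open>a\<close>. It is \<open>S x\<close>; its norm is that of \<open>x\<close> because the fibres are
  infinite, and \<open>A\<^sub>\<xi>\<close> is the fibre of \<open>f\<^sub>\<xi>\<close> over \<open>\<xi>\<close>. Countable cofinality of the countable
  stages makes limits possible: finite modifications turn coherence modulo finite along a cofinal
  sequence into exact extension, while one more point at each step is kept out of the union of
  the fibres.\<close>

section \<open>Coherence of maps modulo finite sets\<close>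

text \<open>A value above \<open>a\<close> only means that the argument lies in no fibre over a point \<open>\<le> a\<close>.\<close>

definition coherent_upto :: "'a::linorder \<Rightarrow> (nat \<Rightarrow> 'a) \<Rightarrow> (nat \<Rightarrow> 'a) \<Rightarrow> bool"
  where "coherent_upto a f g \<longleftrightarrow> (\<forall>\<^sub>\<infinity>n. f n = g n \<or> a < f n \<and> a < g n)"

lemma coherent_upto_refl: "coherent_upto a f f"
  by (simp add: coherent_upto_def)

lemma coherent_upto_trans:
  assumes "coherent_upto a f g" "coherent_upto b g h" "a \<le> b"
  shows "coherent_upto a f h"
  using assms(1,2) unfolding coherent_upto_def
  by (rule MOST_rev_mp[OF _ MOST_mono]) (use assms(3) in auto)

lemma coherent_upto_sym: "coherent_upto a f g \<Longrightarrow> coherent_upto a g f"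
  unfolding coherent_upto_def by (erule MOST_mono) auto

lemma coherent_upto_fibre:
  assumes "coherent_upto a f g" "b \<le> a"
  shows "\<forall>\<^sub>\<infinity>n. f n = b \<longleftrightarrow> g n = b"
  using assms(1) unfolding coherent_upto_def by (rule MOST_mono) (use assms(2) in auto)

text \<open>The last conjunct keeps infinitely many arguments outside all fibres over points \<le>
  \<open>a\<close>; later fibres are cut from this room.\<close>

definition spread_upto :: "'a::linorder \<Rightarrow> (nat \<Rightarrow> 'a) \<Rightarrow> bool"
  where "spread_upto a f \<longleftrightarrow> (\<forall>b\<le>a. \<exists>\<^sub>\<infinity>n. f n = b) \<and> (\<exists>\<^sub>\<infinity>n. a < f n)"

section \<open>Limits of coherent sequences\<close>

lemma coherent_sequence_limit:
  fixes a :: "nat \<Rightarrow> 'a::linorder" and f :: "nat \<Rightarrow> nat \<Rightarrow> 'a"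
  assumes mono: "mono a" and bound: "\<And>n. a n < b"
    and coh: "\<And>n. coherent_upto (a n) (f n) (f (Suc n))"
    and room: "\<And>n. \<exists>\<^sub>\<infinity>m. a n < f n m"
  obtains g where "\<And>n. coherent_upto (a n) (f n) g" "\<exists>\<^sub>\<infinity>m. b \<le> g m"
proof -
  \<comment> \<open>\<open>P\<close> collects the arguments kept out of the fibres below \<open>b\<close> for good.\<close>
  define ok where "ok n s \<longleftrightarrow> (case s of (g, P) \<Rightarrow>
      finite P \<and> card P = n \<and> (\<forall>m\<in>P. a n < g m) \<and> coherent_upto (a n) g (f n))" for n s
  \<comment> \<open>Such steps compose along the increasing bounds \<open>a n\<close>, so the limit
    will agree exactly with every stage.\<close>
  define ext where "ext n s s' \<longleftrightarrow> (case s of (g, P) \<Rightarrow> case s' of (g', P') \<Rightarrow>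
      P \<subseteq> P' \<and> (\<forall>m. if g m \<le> a n then g' m = g m else a n < g' m))"
    for n and s s' :: "(nat \<Rightarrow> 'a) \<times> nat set"
  have "\<exists>s. \<forall>n. ok n (s n) \<and> ext n (s n) (s (Suc n))"
  proof (rule dependent_nat_choice)
    show "\<exists>s. ok 0 s"
      by (rule exI[of _ "(f 0, {})"]) (simp add: ok_def coherent_upto_refl)
  next
    fix s n assume "ok n s"
    then obtain g P where s: "s = (g, P)" and P: "finite P" "card P = n"
      and gP: "\<And>m. m \<in> P \<Longrightarrow> a n < g m" and g: "coherent_upto (a n) g (f n)"
      by (cases s) (auto simp: ok_def)
    \<comment> \<open>\<open>b\<close> lies above every \<open>a k\<close>, so it is a safe value
      for reserved arguments and for those where \<open>f (Suc n)\<close> drops to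
      \<open>a n\<close> or below. By coherence \<open>g'\<close> still equals
      \<open>f (Suc n)\<close> almost everywhere.\<close>
    define g' where "g' m = (if g m \<le> a n then g m
        else if a n < f (Suc n) m \<and> m \<notin> P then f (Suc n) m else b)" for m
    have "\<forall>\<^sub>\<infinity>m. m \<notin> P"
      using P(1) by (simp add: eventually_cofinite)
    moreover have "\<forall>\<^sub>\<infinity>m. g m = f (Suc n) m \<or> a n < g m \<and> a n < f (Suc n) m"
      using coherent_upto_trans[OF g coh] by (simp add: coherent_upto_def)
    ultimately have g': "\<forall>\<^sub>\<infinity>m. g' m = f (Suc n) m"
      by (rule MOST_rev_mp[OF _ MOST_mono]) (auto simp: g'_def)
    \<comment> \<open>Room above \<open>a (Suc n)\<close> passes from \<open>f (Suc n)\<close> to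
      \<open>g'\<close> and supplies a fresh argument to reserve.\<close>
    have "\<exists>\<^sub>\<infinity>m. a (Suc n) < g' m \<and> m \<notin> P"
      using INFM_conjI[OF INFM_conjI[OF room[of "Suc n"] g'] \<open>\<forall>\<^sub>\<infinity>m. m \<notin> P\<close>]
      by (rule INFM_mono) auto
    then obtain p where p: "a (Suc n) < g' p" "p \<notin> P"
      by (blast dest: INFM_EX)
    have "a (Suc n) < g' m" if "m \<in> P" for m
      using gP[OF that] that bound by (auto simp: g'_def)
    then have "ok (Suc n) (g', insert p P)"
      using p P g' by (auto simp: ok_def coherent_upto_def elim: MOST_mono)
    moreover have "ext n s (g', insert p P)"
      using bound[of n] by (auto simp: ext_def s g'_def)
    ultimately show "\<exists>s'. ok (Suc n) s' \<and> ext n s s'" by blast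
  qed
  then obtain s where ok: "\<And>n. ok n (s n)" and ext: "\<And>n. ext n (s n) (s (Suc n))" by blast
  define G where "G n = fst (s n)" for n
  define P where "P n = snd (s n)" for n
  have P: "finite (P n)" "card (P n) = n" and GP: "m \<in> P n \<Longrightarrow> a n < G n m"
    and G: "coherent_upto (a n) (G n) (f n)" for n m
    using ok[of n] by (auto simp: ok_def G_def P_def split: prod.splits)
  have grow: "P n \<subseteq> P (Suc n)" for n
    using ext[of n] by (auto simp: ext_def P_def split: prod.splits)
  have stay: "G (Suc n) m = G n m" if "G n m \<le> a n" for n m
    using ext[of n] that by (auto simp: ext_def G_def split: prod.splits if_splits)
  have out: "a n < G (Suc n) m" if "a n < G n m" for n m
    using ext[of n] that by (auto simp: ext_def G_def split: prod.splits if_splits)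
  have stays: "G n m = G k m" if "G k m \<le> a k" "k \<le> n" for k n m
    using that(2)
  proof (induction n rule: dec_induct)
    case (step n)
    then show ?case using stay[of n m] that(1) monoD[OF mono, of k n] by auto
  qed simp
  have outs: "a k < G n m" if "a k < G k m" "k \<le> n" for k n m
    using that(2)
  proof (induction n rule: dec_induct)
    case (step n)
    then show ?case
      using stay[of n m] out[of n m] monoD[OF mono, of k n]
      by (metis le_less_trans not_le)
  qed (use that in simp)
  define g where "g m = (if \<exists>k. G k m \<le> a k then G (LEAST k. G k m \<le> a k) m else b)" for m
  \<comment> \<open>This holds at every argument; finitely many exceptions arise only in passing
    from \<open>G n\<close> to \<open>f n\<close>.\<close>
  have gG: "g m = G n m \<or> a n < g m \<and> a n < G n m" for n m
  proof (cases "\<exists>k. G k m \<le> a k")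
    case True
    define k where "k = (LEAST k. G k m \<le> a k)"
    have k: "G k m \<le> a k" "g m = G k m"
      using True LeastI_ex[OF True] by (auto simp: k_def g_def)
    have "g m = G n m" if "k \<le> n" using stays[OF k(1) that] k(2) by simp
    moreover have "a n < G n m" "a n < g m" if "n < k"
    proof -
      show "a n < G n m" using not_less_Least[OF that[unfolded k_def]] by simp
      then show "a n < g m" using outs[of n m k] that k(2) by simp
    qed
    ultimately show ?thesis by fastforce
  next
    case False
    moreover have "g m = b" using False by (simp only: g_def if_False)
    ultimately show ?thesis using bound[of n] by (simp add: not_le)
  qed
  show thesis
  proof (rule that)
    fix n
    have "coherent_upto (a n) (G n) g"
      unfolding coherent_upto_def by (rule ALL_MOST) (metis gG)
    then show "coherent_upto (a n) (f n) g"
      using coherent_upto_trans[OF coherent_upto_sym[OF G]] by blast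
  next
    have "infinite (\<Union>n. P n)"
    proof
      assume "finite (\<Union>n. P n)"
      then have "card (P n) \<le> card (\<Union>n. P n)" for n by (intro card_mono) auto
      then show False using P(2) by (metis Suc_n_not_le_n)
    qed
    moreover have "(\<Union>n. P n) \<subseteq> {m. b \<le> g m}"
    proof (clarify)
      fix n m assume m: "m \<in> P n"
      \<comment> \<open>A value frozen at a stage \<open>k\<close> \<le> \<open>n\<close> would
        persist to stage \<open>n\<close>, against \<open>GP\<close>; at a later stage
        \<open>m\<close> is still reserved.\<close>
      have "\<not> G k m \<le> a k" for k
      proof
        assume k: "G k m \<le> a k"
        show False
        proof (cases "k \<le> n")
          case True
          then show False
            using stays[OF k True] k GP[OF m] monoD[OF mono True] by auto
        next
          case False
          have "P n \<subseteq> P k"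
            using lift_Suc_mono_le[of P, OF grow] False by simp
          then show False using GP[of m k] m k by auto
        qed
      qed
      then show "b \<le> g m" by (simp add: g_def)
    qed
    ultimately show "\<exists>\<^sub>\<infinity>m. b \<le> g m"
      unfolding INFM_iff_infinite using finite_subset by blast
  qed
qed

section \<open>Recursion along a well-order with countable initial segments\<close>

lemma infinite_nat_halves:
  assumes "infinite (X :: nat set)"
  obtains Y where "Y \<subseteq> X" "infinite Y" "infinite (X - Y)"
proof -
  obtain e :: "nat \<Rightarrow> nat" where e: "inj e" "range e \<subseteq> X"
    using infinite_countable_subset[OF assms] by blast
  have "inj (\<lambda>n. e (2 * n))" "inj (\<lambda>n. e (2 * n + 1))"
    by (auto intro!: injI simp: inj_eq[OF e(1)])
  then have inf: "infinite (range (\<lambda>n. e (2 * n)))" "infinite (range (\<lambda>n. e (2 * n + 1)))"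
    by (simp_all only: range_inj_infinite not_False_eq_True)
  have "e (2 * m + 1) \<noteq> e (2 * n)" for m n
  proof
    assume "e (2 * m + 1) = e (2 * n)"
    then have "2 * m + 1 = 2 * n" using e(1) by (simp only: inj_eq)
    then show False by presburger
  qed
  then have "range (\<lambda>n. e (2 * n + 1)) \<subseteq> X - range (\<lambda>n. e (2 * n))"
    using e(2) by (auto simp: image_subset_iff)
  then have "infinite (X - range (\<lambda>n. e (2 * n)))"
    using inf(2) finite_subset by blast
  then show thesis
    using that[of "range (\<lambda>n. e (2 * n))"] inf(1) e(2) by (simp add: image_subset_iff)
qed

text \<open>One argument covers successor and limit stages: a limit along a cofinal sequence leaves
  infinite room, of which one half becomes the fibre over \<open>b\<close> and the other stays
  free.\<close>

lemma coherent_extension: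
  fixes f :: "'a::{wellorder, no_top} \<Rightarrow> nat \<Rightarrow> 'a"
  assumes ctbl: "countable {..<b}"
    and spread: "\<And>x. x < b \<Longrightarrow> spread_upto x (f x)"
    and coh: "\<And>x y. x \<le> y \<Longrightarrow> y < b \<Longrightarrow> coherent_upto x (f x) (f y)"
  obtains h where "spread_upto b h" "\<And>x. x < b \<Longrightarrow> coherent_upto x (f x) h"
proof -
  obtain g where g: "\<And>x. x < b \<Longrightarrow> coherent_upto x (f x) g" and room: "\<exists>\<^sub>\<infinity>m. b \<le> g m"
  proof (cases "{..<b} = {}")
    case True
    then show thesis by (intro that[of "\<lambda>_. b"]) (auto simp: INFM_const)
  next
    case False
    define e where "e = from_nat_into {..<b}"
    \<comment> \<open>Running maxima turn the enumeration into an increasing sequence cofinal below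
      \<open>b\<close>; it is eventually constant if \<open>b\<close> has an immediate
      predecessor.\<close>
    define a where "a n = Max (e ` {..n})" for n
    have e: "range e = {..<b}"
      using range_from_nat_into[OF False ctbl] by (simp add: e_def)
    have ab: "a n < b" for n
      using e by (auto simp: a_def)
    have "mono a"
      unfolding a_def by (intro monoI Max_mono) auto
    moreover have "coherent_upto (a n) (f (a n)) (f (a (Suc n)))" for n
      using coh monoD[OF \<open>mono a\<close>] ab by simp
    moreover have "\<exists>\<^sub>\<infinity>m. a n < f (a n) m" for n
      using spread[OF ab] by (simp add: spread_upto_def)
    ultimately obtain g where g: "\<And>n. coherent_upto (a n) (f (a n)) g" "\<exists>\<^sub>\<infinity>m. b \<le> g m"
      using coherent_sequence_limit[of a b "\<lambda>n. f (a n)"] ab by metis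
    show thesis
    proof (rule that)
      fix x assume "x < b"
      then obtain n where "x = e n" using e by blast
      then have "x \<le> a n" by (auto simp: a_def)
      then show "coherent_upto x (f x) g"
        using coherent_upto_trans[OF coh g(1)] ab by blast
    qed (rule g(2))
  qed
  obtain Y where Y: "Y \<subseteq> {m. b \<le> g m}" "infinite Y" "infinite ({m. b \<le> g m} - Y)"
    using infinite_nat_halves room unfolding INFM_iff_infinite by blast
  obtain c where c: "b < c" using gt_ex by blast
  \<comment> \<open>Only values \<ge> \<open>b\<close> are overwritten, again by values \<ge>
    \<open>b\<close>, so coherence up to any \<open>x < b\<close> is unaffected; \<open>c\<close>
    marks the room for later stages.\<close>
  define h where "h m = (if g m < b then g m else if m \<in> Y then b else c)" for m
  have h: "coherent_upto x (f x) h" if "x < b" for x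
  proof -
    have "coherent_upto x g h"
      using that c by (auto simp: coherent_upto_def h_def intro!: ALL_MOST)
    then show ?thesis using coherent_upto_trans[OF g[OF that]] by blast
  qed
  have "\<exists>\<^sub>\<infinity>m. h m = x" if "x < b" for x
  proof -
    have "\<exists>\<^sub>\<infinity>m. f x m = x" using spread[OF that] by (simp add: spread_upto_def)
    from INFM_conjI[OF this coherent_upto_fibre[OF h[OF that] order_refl]]
    show ?thesis by (rule INFM_mono) auto
  qed
  moreover have "\<exists>\<^sub>\<infinity>m. h m = b"
    unfolding INFM_iff_infinite
    by (rule infinite_super[OF _ Y(2)]) (use Y(1) in \<open>auto simp: h_def\<close>)
  moreover have "\<exists>\<^sub>\<infinity>m. b < h m"
    unfolding INFM_iff_infinite
    by (rule infinite_super[OF _ Y(3)]) (use c in \<open>auto simp: h_def\<close>)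
  ultimately have "spread_upto b h" by (auto simp: spread_upto_def le_less)
  then show thesis using h that by blast
qed

text \<open>Well-founded choice applies because the maps chosen below \<open>x\<close> cohere with
  each other, each having been chosen coherent with all its predecessors.\<close>

lemma coherent_family_exists:
  assumes ctbl: "\<And>x :: 'a::{wellorder, no_top}. countable {..<x}"
  obtains f :: "'a::{wellorder, no_top} \<Rightarrow> nat \<Rightarrow> 'a"
  where "\<And>x. spread_upto x (f x)" "\<And>x y. x \<le> y \<Longrightarrow> coherent_upto x (f x) (f y)"
proof -
  have "\<exists>f :: 'a \<Rightarrow> nat \<Rightarrow> 'a. \<forall>x. spread_upto x (f x) \<and> (\<forall>y<x. coherent_upto y (f y) (f x))"
  proof (rule dependent_wf_choice[OF wf])
    fix x :: 'a and f :: "'a \<Rightarrow> nat \<Rightarrow> 'a"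
    assume IH: "\<And>y. (y, x) \<in> {(x, y). x < y} \<Longrightarrow>
        spread_upto y (f y) \<and> (\<forall>z<y. coherent_upto z (f z) (f y))"
    have "coherent_upto z (f z) (f y)" if "z \<le> y" "y < x" for y z
      using IH[of y] that coherent_upto_refl by (cases "z = y") auto
    then show "\<exists>r. spread_upto x r \<and> (\<forall>y<x. coherent_upto y (f y) r)"
      using IH by (auto intro: coherent_extension[OF ctbl, of x f])
  qed auto
  then show thesis using that coherent_upto_refl by (metis le_less)
qed

section \<open>A well-order of minimal type on the index set\<close>

instantiation omega1 :: wellorder
begin

text \<open>\<open>card_of\<close> yields a well-order of minimal type, so proper initial segments
  have smaller cardinality and are therefore countable.\<close>

definition less_eq_omega1 :: "omega1 \<Rightarrow> omega1 \<Rightarrow> bool"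
  where "less_eq_omega1 x y \<longleftrightarrow> (x, y) \<in> card_of (UNIV :: omega1 set)"

definition less_omega1 :: "omega1 \<Rightarrow> omega1 \<Rightarrow> bool"
  where "less_omega1 x y \<longleftrightarrow> x \<le> y \<and> x \<noteq> y"

instance
proof
  have "well_order_on UNIV (card_of (UNIV :: omega1 set))"
    by (rule card_of_well_order_on)
  then have lin: "refl (card_of (UNIV :: omega1 set))" "trans (card_of (UNIV :: omega1 set))"
      "antisym (card_of (UNIV :: omega1 set))" "total (card_of (UNIV :: omega1 set))"
    and wf: "wf (card_of (UNIV :: omega1 set) - Id)"
    by (auto simp: order_on_defs)
  fix x y z :: omega1
  show anti: "x \<le> y \<Longrightarrow> y \<le> x \<Longrightarrow> x = y"
    using lin(3) unfolding less_eq_omega1_def by (rule antisymD)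
  show "(x < y) = (x \<le> y \<and> \<not> y \<le> x)"
    using antisymD[OF lin(3), of x y] reflD[OF lin(1)]
    by (auto simp: less_omega1_def less_eq_omega1_def)
  show "x \<le> x"
    using lin(1) by (simp add: less_eq_omega1_def reflD)
  show "x \<le> y \<Longrightarrow> y \<le> z \<Longrightarrow> x \<le> z"
    using lin(2) unfolding less_eq_omega1_def by (rule transD)
  show "x \<le> y \<or> y \<le> x"
    using lin(1,4) unfolding less_eq_omega1_def total_on_def by (metis UNIV_I reflD)
  fix P :: "omega1 \<Rightarrow> bool" and a :: omega1
  assume "\<And>x. (\<And>y. y < x \<Longrightarrow> P y) \<Longrightarrow> P x"
  then show "P a"
    using wf_induct_rule[OF wf, of P a] by (auto simp: less_omega1_def less_eq_omega1_def)
qed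

end

lemma uncountable_omega1: "uncountable (UNIV :: omega1 set)"
proof
  assume "countable (UNIV :: omega1 set)"
  then have "(cardSuc natLeq, natLeq) \<in> ordLeq"
    using card_of_omega1 ordIso_ordLeq_trans ordIso_symmetric
    unfolding countable_card_le_natLeq by blast
  then show False
    using cardSuc_greater[OF natLeq_Card_order] not_ordLess_ordLeq by blast
qed

lemma countable_lessThan_omega1: "countable {..<x :: omega1}"
proof -
  have "{..<x} = underS (card_of (UNIV :: omega1 set)) x"
    by (auto simp: underS_def less_omega1_def less_eq_omega1_def)
  then have "(card_of {..<x}, card_of (UNIV :: omega1 set)) \<in> ordLess"
    using card_of_underS[OF card_of_Card_order, of x "UNIV :: omega1 set"]
    by (simp add: Field_card_of)
  then have "(card_of {..<x}, cardSuc natLeq) \<in> ordLess"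
    using card_of_omega1 ordLess_ordIso_trans by blast
  then show ?thesis
    by (simp add: countable_card_le_natLeq cardSuc_ordLeq_ordLess natLeq_Card_order
        card_of_Card_order)
qed

text \<open>Uncountable cofinality: otherwise countably many countable initial segments would cover
  the type. It bounds the countable supports.\<close>

lemma countable_bounded_omega1:
  assumes "countable (C :: omega1 set)"
  obtains a where "\<And>c. c \<in> C \<Longrightarrow> c < a"
proof (cases "\<exists>a. \<forall>c\<in>C. c < a")
  case False
  then have "UNIV = (\<Union>c\<in>C. insert c {..<c})"
    by (auto simp: not_less le_less)
  moreover have "countable (\<Union>c\<in>C. insert c {..<c})"
    using assms by (intro countable_UN countable_insert countable_lessThan_omega1)
  ultimately show ?thesis using uncountable_omega1 by simp
qed (use that in blast)

instance omega1 :: no_top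
  by standard (metis countable_bounded_omega1 countable_empty countable_insert insertI1)

section \<open>Limits along free ultrafilters\<close>

definition nstar_filter :: "nstar \<Rightarrow> nat filter"
  where "nstar_filter p = Abs_filter (\<lambda>P. {n. P n} \<in> sets_of p)"

lemma sets_of_mono: "A \<in> sets_of p \<Longrightarrow> A \<subseteq> B \<Longrightarrow> B \<in> sets_of p"
  using sets_of_ultrafilter[of p] by (auto simp: ultrafilter_on_nat_def)

lemma Int_in_sets_of: "A \<inter> B \<in> sets_of p \<longleftrightarrow> A \<in> sets_of p \<and> B \<in> sets_of p"
  using star_Int[of A B] by (auto simp: star_def)

lemma Compl_in_sets_of: "- A \<in> sets_of p \<longleftrightarrow> A \<notin> sets_of p"
  using star_Compl[of A] by (auto simp: star_def)

lemma eventually_nstar_filter: "eventually P (nstar_filter p) \<longleftrightarrow> {n. P n} \<in> sets_of p"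
  unfolding nstar_filter_def
proof (rule eventually_Abs_filter, unfold_locales)
  have "UNIV \<in> sets_of p"
    using Compl_in_sets_of[of "{}" p] sets_of_infinite by auto
  then show "{n. True} \<in> sets_of p" by simp
  fix P Q :: "nat \<Rightarrow> bool"
  show "{n. P n \<and> Q n} \<in> sets_of p" if "{n. P n} \<in> sets_of p" "{n. Q n} \<in> sets_of p"
    using that by (simp add: Collect_conj_eq Int_in_sets_of)
  show "{n. Q n} \<in> sets_of p" if "\<forall>n. P n \<longrightarrow> Q n" "{n. P n} \<in> sets_of p"
    using sets_of_mono[OF that(2)] that(1) by blast
qed

lemma nstar_filter_neq_bot: "nstar_filter p \<noteq> bot"
  using sets_of_infinite[of "{}" p] by (auto simp: trivial_limit_def eventually_nstar_filter)

text \<open>Freeness of \<open>p\<close>: altering finitely many terms does not change a limit along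
  it.\<close>

lemma nstar_filter_le_cofinite: "nstar_filter p \<le> cofinite"
proof (rule filter_leI)
  fix P :: "nat \<Rightarrow> bool" assume "eventually P cofinite"
  then have "{n. \<not> P n} \<notin> sets_of p"
    using sets_of_infinite by (auto simp: eventually_cofinite)
  then show "eventually P (nstar_filter p)"
    using Compl_in_sets_of[of "{n. \<not> P n}" p] by (simp add: eventually_nstar_filter Collect_neg_eq)
qed

text \<open>For bounded \<open>u\<close> this is the continuous extension of \<open>u\<close> to
  \<beta>\<nat>, restricted to the remainder.\<close>

definition nstar_lim :: "(nat \<Rightarrow> real) \<Rightarrow> nstar \<Rightarrow> real"
  where "nstar_lim u p = Lim (nstar_filter p) u"

lemma nstar_lim_eqI: "(u \<longlongrightarrow> l) (nstar_filter p) \<Longrightarrow> nstar_lim u p = l"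
  unfolding nstar_lim_def by (rule tendsto_Lim[OF nstar_filter_neq_bot])

text \<open>Compactness gives a cluster point of the image filter; as \<open>p\<close> decides every
  set, the filter converges to it.\<close>

lemma tendsto_nstar_lim:
  assumes "bounded (range u)"
  shows "(u \<longlongrightarrow> nstar_lim u p) (nstar_filter p)"
proof -
  define F where "F = filtermap u (nstar_filter p)"
  have "compact (closure (range u))"
    using assms by (simp add: compact_closure)
  moreover have "F \<noteq> bot"
    by (simp add: F_def filtermap_bot_iff nstar_filter_neq_bot)
  moreover have "eventually (\<lambda>x. x \<in> closure (range u)) F"
    by (simp add: F_def eventually_filtermap closure_subset[THEN subsetD] eventuallyI)
  ultimately obtain l where l: "inf (nhds l) F \<noteq> bot"
    unfolding compact_filter by blast
  have "(u \<longlongrightarrow> l) (nstar_filter p)"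
  proof (rule topological_tendstoI, rule ccontr)
    fix S assume S: "open S" "l \<in> S" "\<not> eventually (\<lambda>n. u n \<in> S) (nstar_filter p)"
    then have "eventually (\<lambda>n. u n \<notin> S) (nstar_filter p)"
      using Compl_in_sets_of[of "{n. u n \<in> S}" p]
      by (simp add: eventually_nstar_filter Collect_neg_eq)
    then have "eventually (\<lambda>x. x \<notin> S) F" by (simp add: F_def eventually_filtermap)
    moreover have "eventually (\<lambda>x. x \<in> S) (nhds l)"
      using S by (simp add: eventually_nhds_in_open)
    ultimately have "eventually (\<lambda>x. False) (inf (nhds l) F)"
      unfolding eventually_inf by fast
    then show False using l by (simp add: trivial_limit_def)
  qed
  then show ?thesis using nstar_lim_eqI by blast
qed

lemma continuous_on_nstar_lim:
  assumes "bounded (range u)"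
  shows "continuous_on UNIV (nstar_lim u)"
  unfolding continuous_on_def tendsto_iff
proof (intro ballI allI impI)
  fix p and e :: real assume "0 < e"
  \<comment> \<open>\<open>A\<close> belongs to \<open>p\<close>, so \<open>star A\<close> is a
    neighbourhood of \<open>p\<close>. Limits preserve only weak inequalities, hence the margin
    \<open>e / 2\<close>.\<close>
  define A where "A = {n. dist (u n) (nstar_lim u p) < e / 2}"
  have "p \<in> star A"
    using tendstoD[OF tendsto_nstar_lim[OF assms], of "e / 2" p] \<open>0 < e\<close>
    by (simp add: A_def star_def eventually_nstar_filter)
  moreover have "dist (nstar_lim u q) (nstar_lim u p) < e" if "q \<in> star A" for q
  proof -
    have "A \<in> sets_of q" using that by (simp add: star_def)
    then have "eventually (\<lambda>n. dist (u n) (nstar_lim u p) \<le> e / 2) (nstar_filter q)"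
      unfolding eventually_nstar_filter by (rule sets_of_mono) (auto simp: A_def)
    then have "dist (nstar_lim u q) (nstar_lim u p) \<le> e / 2"
      using tendsto_upperbound[OF tendsto_dist[OF tendsto_nstar_lim[OF assms] tendsto_const]]
        nstar_filter_neq_bot by blast
    then show ?thesis using \<open>0 < e\<close> by simp
  qed
  ultimately show "eventually (\<lambda>q. dist (nstar_lim u q) (nstar_lim u p) < e) (at p)"
    using clopen_star(1)[of A] unfolding eventually_at_topological by blast
qed

lemma apply_Bcontfun_nstar_lim:
  assumes "bounded (range u)"
  shows "apply_bcontfun (Bcontfun (nstar_lim u)) = nstar_lim u"
  using continuous_on_nstar_lim[OF assms]
  by (intro Bcontfun_inverse) (simp add: continuous_on_nstar_bcontfun)

section \<open>The isometric embedding\<close>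

lemma bounded_range_compose_bcontfun:
  fixes x :: "'a::topological_space \<Rightarrow>\<^sub>C 'b::real_normed_vector"
  shows "bounded (range (\<lambda>n. apply_bcontfun x (f n)))"
  using norm_bounded[of x] by (auto simp: bounded_iff)

text \<open>Up to finitely many arguments, where the two maps differ both values exceed the smaller
  index, and there \<open>x\<close> vanishes.\<close>

lemma coherent_family_compose:
  fixes x :: "'a::linorder \<Rightarrow> real"
  assumes "\<And>a b. a \<le> b \<Longrightarrow> coherent_upto a (f a) (f b)"
    and "\<And>c. x c \<noteq> 0 \<Longrightarrow> c \<le> a" "\<And>c. x c \<noteq> 0 \<Longrightarrow> c \<le> b"
  shows "\<forall>\<^sub>\<infinity>n. x (f a n) = x (f b n)"
proof -
  have *: "\<forall>\<^sub>\<infinity>n. x (f a n) = x (f b n)" if "a \<le> b" "\<And>c. x c \<noteq> 0 \<Longrightarrow> c \<le> a" for a b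
  proof -
    have "\<forall>\<^sub>\<infinity>n. f a n = f b n \<or> a < f a n \<and> a < f b n"
      using assms(1)[OF that(1)] by (simp add: coherent_upto_def)
    then show ?thesis by (rule MOST_mono) (metis that(2) leD)
  qed
  show ?thesis
  proof (cases "a \<le> b")
    case True
    then show ?thesis using * assms(2) by blast
  next
    case False
    then have "\<forall>\<^sub>\<infinity>n. x (f b n) = x (f a n)" using assms(3) by (intro *) auto
    then show ?thesis by (rule MOST_mono) simp
  qed
qed

theorem proposition3p1:
  shows "\<exists>(A :: omega1 \<Rightarrow> nat set) (S :: (omega1 \<Rightarrow>\<^sub>C real) \<Rightarrow> (nstar \<Rightarrow>\<^sub>C real)).
    inj A \<and> almost_disjoint_family (range A) \<and>
    isometric_embedding_on linf_c S \<and>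
    (\<forall>\<xi>. S (char_point \<xi>) = char_star (A \<xi>))"
proof -
  obtain f :: "omega1 \<Rightarrow> nat \<Rightarrow> omega1" where spread: "\<And>a. spread_upto a (f a)"
    and coh: "\<And>a b. a \<le> b \<Longrightarrow> coherent_upto a (f a) (f b)"
    using coherent_family_exists countable_lessThan_omega1 by metis
  define A where "A a = {n. f a n = a}" for a
  have infA: "infinite (A a)" for a
    using spread[of a] by (simp add: A_def spread_upto_def INFM_iff_infinite)
  have disj: "finite (A a \<inter> A b)" if "a < b" for a b
  proof -
    \<comment> \<open>An argument in both sets has \<open>f a n = a\<close> but
      \<open>f b n = b\<close>, which coherence allows only finitely often.\<close>
    have "\<forall>\<^sub>\<infinity>n. f a n = a \<longleftrightarrow> f b n = a"
      using coherent_upto_fibre[OF coh] that by auto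
    then have "\<forall>\<^sub>\<infinity>n. n \<notin> A a \<inter> A b"
      by (rule MOST_mono) (use that in \<open>auto simp: A_def\<close>)
    then show ?thesis by (simp add: eventually_cofinite Int_def)
  qed
  then have ad: "finite (A a \<inter> A b)" if "a \<noteq> b" for a b
    using that by (metis Int_commute neq_iff)
  have inj: "inj A"
    using ad infA by (metis Int_absorb injI)

  define bd where "bd x a \<longleftrightarrow> (\<forall>c. apply_bcontfun x c \<noteq> 0 \<longrightarrow> c \<le> a)"
    for x :: "omega1 \<Rightarrow>\<^sub>C real" and a
  \<comment> \<open>All bounds of the support give the same limits, so the choice made by
    \<open>SOME\<close> is harmless; the fact \<open>S\<close> below passes to any bound.\<close>
  define S where "S x = Bcontfun (nstar_lim (\<lambda>n. apply_bcontfun x (f (SOME a. bd x a) n)))" for x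
  have ex_bd: "\<exists>a. bd x a" if x: "x \<in> linf_c" for x
  proof -
    obtain a where "\<And>c. c \<in> {c. apply_bcontfun x c \<noteq> 0} \<Longrightarrow> c < a"
      using countable_bounded_omega1 x unfolding linf_c_def by blast
    then show ?thesis by (auto simp: bd_def intro!: exI[of _ a] less_imp_le)
  qed
  have S: "((\<lambda>n. apply_bcontfun x (f a n)) \<longlongrightarrow> apply_bcontfun (S x) p) (nstar_filter p)"
    if "bd x a" for x a p
  proof -
    have "bd x (SOME a. bd x a)" using that by (rule someI)
    then have "\<forall>\<^sub>\<infinity>n. apply_bcontfun x (f (SOME a. bd x a) n) = apply_bcontfun x (f a n)"
      using that by (intro coherent_family_compose[OF coh]) (auto simp: bd_def)
    then have "eventually (\<lambda>n. apply_bcontfun x (f (SOME a. bd x a) n) = apply_bcontfun x (f a n))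
        (nstar_filter p)"
      by (rule filter_leD[OF nstar_filter_le_cofinite])
    moreover have "((\<lambda>n. apply_bcontfun x (f (SOME a. bd x a) n)) \<longlongrightarrow> apply_bcontfun (S x) p)
        (nstar_filter p)"
      unfolding S_def apply_Bcontfun_nstar_lim[OF bounded_range_compose_bcontfun]
      by (rule tendsto_nstar_lim[OF bounded_range_compose_bcontfun])
    ultimately show ?thesis by (rule Lim_transform_eventually[rotated])
  qed
  note uniq = tendsto_unique[OF nstar_filter_neq_bot]

  have add: "S (x + y) = S x + S y" if xy: "x \<in> linf_c" "y \<in> linf_c" for x y
  proof (rule bcontfun_eqI)
    fix p
    obtain a b where "bd x a" "bd y b" using ex_bd xy by blast
    then have "bd x (max a b)" "bd y (max a b)" by (auto simp: bd_def le_max_iff_disj)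
    then obtain c where c: "bd x c" "bd y c" by blast
    then have "bd (x + y) c" unfolding bd_def plus_bcontfun.rep_eq by (metis add_0)
    from S[OF this, of p] tendsto_add[OF S[OF c(1), of p] S[OF c(2), of p]]
    show "apply_bcontfun (S (x + y)) p = apply_bcontfun (S x + S y) p"
      by (simp add: plus_bcontfun.rep_eq uniq)
  qed
  have scale: "S (r *\<^sub>R x) = r *\<^sub>R S x" if x: "x \<in> linf_c" for r x
  proof (rule bcontfun_eqI)
    fix p
    obtain a where a: "bd x a" using ex_bd x by blast
    then have "bd (r *\<^sub>R x) a" by (auto simp: bd_def scaleR_bcontfun.rep_eq)
    from S[OF this, of p] tendsto_scaleR[OF tendsto_const S[OF a, of p], of r]
    show "apply_bcontfun (S (r *\<^sub>R x)) p = apply_bcontfun (r *\<^sub>R S x) p"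
      by (simp add: scaleR_bcontfun.rep_eq uniq)
  qed
  have "norm (S x) = norm x" if x: "x \<in> linf_c" for x
  proof (rule antisym)
    obtain a where a: "bd x a" using ex_bd x by blast
    show "norm (S x) \<le> norm x"
    proof (rule norm_bound)
      fix p
      show "norm (apply_bcontfun (S x) p) \<le> norm x"
        using norm_bounded[of x]
        by (intro tendsto_upperbound[OF tendsto_norm[OF S[OF a]]] always_eventually
            nstar_filter_neq_bot) simp
    qed
    \<comment> \<open>For \<open>c\<close> \<le> \<open>a\<close> the fibre of \<open>f a\<close>
      over \<open>c\<close> is infinite, so some free ultrafilter contains it; at that point
      \<open>S x\<close> takes the value of \<open>x\<close> at \<open>c\<close>.\<close>
    show "norm x \<le> norm (S x)"
    proof (rule norm_bound)
      fix c
      show "norm (apply_bcontfun x c) \<le> norm (S x)"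
      proof (cases "c \<le> a")
        case True
        then have "star {n. f a n = c} \<noteq> {}"
          using spread[of a] by (simp add: star_empty_iff spread_upto_def INFM_iff_infinite)
        then obtain p where "{n. f a n = c} \<in> sets_of p" by (auto simp: star_def)
        then have "eventually (\<lambda>n. apply_bcontfun x (f a n) = apply_bcontfun x c) (nstar_filter p)"
          unfolding eventually_nstar_filter by (rule sets_of_mono) auto
        then have "((\<lambda>n. apply_bcontfun x (f a n)) \<longlongrightarrow> apply_bcontfun x c) (nstar_filter p)"
          by (rule tendsto_eventually)
        then have "apply_bcontfun (S x) p = apply_bcontfun x c"
          using uniq[OF S[OF a]] by blast
        then show ?thesis using norm_bounded[of "S x" p] by simp
      next
        case False
        then have "apply_bcontfun x c = 0" using a by (auto simp: bd_def)
        then show ?thesis by simp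
      qed
    qed
  qed
  then have "isometric_embedding_on linf_c S"
    using add scale by (simp add: isometric_embedding_on_def)
  moreover have "S (char_point a) = char_star (A a)" for a
  proof (rule bcontfun_eqI)
    fix p
    \<comment> \<open>The bound \<open>a\<close> is sharp here, so \<open>S\<close> may be computed
      with \<open>f a\<close> itself: the composite is the indicator of \<open>A a\<close>, constant
      on a set in \<open>p\<close>.\<close>
    have "bd (char_point a) a" by (auto simp: bd_def char_point.rep_eq indicator_def)
    note lim = S[OF this, of p]
    have "eventually (\<lambda>n. n \<in> A a \<longleftrightarrow> A a \<in> sets_of p) (nstar_filter p)"
      using Compl_in_sets_of[of "A a" p]
      by (cases "A a \<in> sets_of p") (simp_all add: eventually_nstar_filter Collect_neg_eq)
    then have "eventually (\<lambda>n. apply_bcontfun (char_point a) (f a n) =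
        apply_bcontfun (char_star (A a)) p) (nstar_filter p)"
      by (rule eventually_mono)
        (auto simp: char_point.rep_eq char_star.rep_eq A_def star_def indicator_def)
    then show "apply_bcontfun (S (char_point a)) p = apply_bcontfun (char_star (A a)) p"
      using uniq[OF lim tendsto_eventually] by blast
  qed
  moreover have "infinite (range A)"
    using inj uncountable_omega1 by (metis countable_finite finite_imageD)
  then have "almost_disjoint_family (range A)"
    using infA ad unfolding almost_disjoint_family_def by (metis imageE)
  ultimately show ?thesis using inj by blast
qed

end
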